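(* Let $k>2$, $n$ with $\pi(\sqrt{n})-\pi(\sqrt[k]{n})\geq 2$, and \[ m\geq\max_{A\in CS_k^{max}(n)}\ \min_{a\in A,\ \omega(a)>1}\mathrm{ssp}(a)^k \] be positive integers. Then no maximum $(n,k)$-shelf is a subset of any maximum $(m,k)$-shelf.
   Context: $\mathbb{N}$ is the set of positive integers, $\mathbb{P}$ the set of primes, $[n]:=\{1,2,\dots,n\}$, and $p\mathbb{N}$ the set of positive multiples of $p$. For a finite set $A\subseteq\mathbb{N}$ and a prime $p$, $o_p(A):=|A\cap p\mathbb{N}|$ is the number of elements of $A$ divisible by $p$. For positive integers $k,n$ define $CS_k(n):=\{A\subseteq[n]: o_p(A)\leq k\text{ for all }p\in\mathbb{P}\}$; its elements are called $(n,k)$-shelves. $CS_k^{max}(n)$ is the set of elements of $CS_k(n)$ of maximal cardinality; its elements are called maximum $(n,k)$-shelves. $\pi(x)$ is the number of primes $\leq x$, $\omega(a)$ is the number of distinct prime divisors of $a$, and $\mathrm{ssp}(a)$ is the second smallest prime divisor of $a$ (defined when $\omega(a)>1$). *)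

theory Defs
  imports Complex_Main "HOL-Computational_Algebra.Primes"
begin

definition prime_pi :: "real \<Rightarrow> nat" where
  "prime_pi x = card {p::nat. prime p \<and> real p \<le> x}"

definition num_prime_divisors :: "nat \<Rightarrow> nat" where
  "num_prime_divisors a = card (prime_factors a)"

text \<open>
  Prime divisors are counted without multiplicity, so the value below is the second smallest
  distinct prime divisor. It is only meaningful if \<open>num_prime_divisors a > 1\<close>.
\<close>
definition ssp :: "nat \<Rightarrow> nat" where
  "ssp a = Min (prime_factors a - {Min (prime_factors a)})"

definition num_multiples :: "nat \<Rightarrow> nat set \<Rightarrow> nat" where
  "num_multiples p A = card (A \<inter> {a. a > 0 \<and> p dvd a})"

definition shelves :: "nat \<Rightarrow> nat \<Rightarrow> nat set set" where
  "shelves k n = {A. A \<subseteq> {1..n} \<and> (\<forall>p. prime p \<longrightarrow> num_multiples p A \<le> k)}"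

definition max_shelves :: "nat \<Rightarrow> nat \<Rightarrow> nat set set" where
  "max_shelves k n = {A \<in> shelves k n. \<forall>B \<in> shelves k n. card B \<le> card A}"

text \<open>
  All minima and the maximum range over nonempty finite sets whenever
  \<open>k \<ge> 1\<close> and two distinct primes \<open>p < q\<close> lie in the interval from the \<open>k\<close>-th root of \<open>n\<close>
  (exclusive) to the square root of \<open>n\<close> (inclusive): a shelf containing only \<open>1\<close> and prime
  powers has fewer than \<open>k\<close> multiples of \<open>p\<close> and of \<open>q\<close>, and so can be enlarged by \<open>p * q\<close>.
\<close>
definition ssp_bound :: "nat \<Rightarrow> nat \<Rightarrow> nat" where
  "ssp_bound k n =
     (MAX A \<in> max_shelves k n. MIN a \<in> {a \<in> A. num_prime_divisors a > 1}. ssp a ^ k)"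

end

theory Submission
  imports Defs
begin

text \<open>
  If an element \<open>a\<close> of a maximum \<open>(m,k)\<close>-shelf is divisible by distinct primes \<open>p\<close> and \<open>q\<close>, then
  \<open>p ^ k\<close> and \<open>q ^ k\<close> cannot both be at most \<open>m\<close>: the shelf would miss a power of \<open>p\<close> and a power
  of \<open>q\<close> in \<open>{1..m}\<close>, and replacing \<open>a\<close> by these two would enlarge it. On the other hand, every
  maximum \<open>(n,k)\<close>-shelf contains an element with at least two prime divisors, and the
  assumption on \<open>m\<close> says that its second smallest prime divisor can be chosen with \<open>k\<close>-th power at
  most \<open>m\<close>.
\<close>

lemma finite_shelf: "A \<in> shelves k n \<Longrightarrow> finite A"
  unfolding shelves_def using finite_subset by blast

lemma finite_max_shelves: "finite (max_shelves k n)"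
  by (rule finite_subset[of _ "Pow {1..n}"]) (auto simp: max_shelves_def shelves_def)

text \<open>Only an inequality, because \<open>x\<close> may already lie in \<open>A\<close>.
  Writing the increment as \<open>of_bool\<close> lets several insertions and a removal be chained
  arithmetically.\<close>

lemma num_multiples_insert_le:
  assumes "finite A"
  shows "num_multiples r (insert x A) \<le> num_multiples r A + of_bool (r dvd x)"
proof -
  have "insert x A \<inter> {a. a > 0 \<and> r dvd a} \<subseteq>
      (if r dvd x then insert x (A \<inter> {a. a > 0 \<and> r dvd a}) else A \<inter> {a. a > 0 \<and> r dvd a})"
    by auto
  then have "num_multiples r (insert x A) \<le>
      card (if r dvd x then insert x (A \<inter> {a. a > 0 \<and> r dvd a}) else A \<inter> {a. a > 0 \<and> r dvd a})"
    unfolding num_multiples_def using assms by (intro card_mono) auto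
  also have "\<dots> \<le> num_multiples r A + of_bool (r dvd x)"
    unfolding num_multiples_def using assms by (simp add: card_insert_if)
  finally show ?thesis .
qed

lemma num_multiples_remove:
  assumes "finite A" "a \<in> A" "a > 0"
  shows "num_multiples r (A - {a}) + of_bool (r dvd a) = num_multiples r A"
proof (cases "r dvd a")
  case True
  then have "A \<inter> {a. a > 0 \<and> r dvd a} = insert a ((A - {a}) \<inter> {a. a > 0 \<and> r dvd a})"
    using assms by auto
  then show ?thesis
    unfolding num_multiples_def using True assms by simp
next
  case False
  then have "(A - {a}) \<inter> {a. a > 0 \<and> r dvd a} = A \<inter> {a. a > 0 \<and> r dvd a}"
    by auto
  then show ?thesis
    unfolding num_multiples_def using False by simp
qed

text \<open>Since \<open>q\<close> divides \<open>a\<close>, it is no power of \<open>p\<close>. If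
  all of \<open>p ^ 1\<close>, ..., \<open>p ^ k\<close> were in \<open>A\<close>, then together
  with \<open>a\<close> they would be \<open>k + 1\<close> multiples of \<open>p\<close>.\<close>

lemma shelf_misses_prime_power:
  assumes A: "A \<in> shelves k n" and "a \<in> A"
    and p: "prime p" "p dvd a" and q: "prime q" "q dvd a" and "p \<noteq> q"
  shows "\<exists>i\<in>{1..k}. p ^ i \<notin> A"
proof (rule ccontr)
  assume "\<not> ?thesis"
  then have powers: "(\<lambda>i. p ^ i) ` {1..k} \<subseteq> A"
    by auto
  have "a > 0"
    using A \<open>a \<in> A\<close> unfolding shelves_def by auto
  have "a \<notin> (\<lambda>i. p ^ i) ` {1..k}"
    using p q \<open>p \<noteq> q\<close> by (metis imageE prime_dvd_power primes_dvd_imp_eq)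
  moreover have "inj_on (\<lambda>i. p ^ i) {1..k}"
    using prime_gt_1_nat[OF p(1)] by (auto intro: inj_onI)
  ultimately have "card (insert a ((\<lambda>i. p ^ i) ` {1..k})) = Suc k"
    by (simp add: card_image)
  moreover have "insert a ((\<lambda>i. p ^ i) ` {1..k}) \<subseteq> A \<inter> {a. a > 0 \<and> p dvd a}"
    using powers \<open>a \<in> A\<close> \<open>a > 0\<close> p prime_gt_0_nat by (auto simp: dvd_power)
  ultimately have "Suc k \<le> num_multiples p A"
    unfolding num_multiples_def using finite_shelf[OF A] by (metis card_mono finite_Int)
  moreover have "num_multiples p A \<le> k"
    using A p(1) unfolding shelves_def by blast
  ultimately show False by simp
qed

text \<open>It suffices to bound the larger prime, since \<open>q ^ k \<le> m\<close> forces
  \<open>p ^ k \<le> m\<close>. This is the form that fits \<open>ssp\<close>.\<close>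

lemma max_shelf_prime_power_gt:
  assumes B: "B \<in> max_shelves k m" and "a \<in> B"
    and p: "prime p" "p dvd a" and q: "prime q" "q dvd a" and "p < q"
  shows "q ^ k > m"
proof (rule ccontr)
  assume "\<not> q ^ k > m"
  then have qk: "q ^ k \<le> m" by simp
  then have pk: "p ^ k \<le> m"
    using \<open>p < q\<close> by (meson le_trans less_imp_le power_mono zero_le)
  have shelf: "B \<in> shelves k m"
    using B unfolding max_shelves_def by simp
  note fin = finite_shelf[OF shelf]
  obtain i where i: "i \<in> {1..k}" "p ^ i \<notin> B"
    using shelf_misses_prime_power[OF shelf \<open>a \<in> B\<close> p q] \<open>p < q\<close> by auto
  obtain j where j: "j \<in> {1..k}" "q ^ j \<notin> B"
    using shelf_misses_prime_power[OF shelf \<open>a \<in> B\<close> q p] \<open>p < q\<close> by auto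
  have "p > 1" "q > 1"
    using p q prime_gt_1_nat by auto
  have le: "p ^ i \<le> m" "q ^ j \<le> m"
    using i j pk qk \<open>p > 1\<close> \<open>q > 1\<close> by (meson atLeastAtMost_iff le_trans less_imp_le power_increasing)+
  \<comment> \<open>The exponents are at least 1, so neither power degenerates to 1.\<close>
  have dvd_p: "r dvd p ^ i \<longleftrightarrow> r = p" and dvd_q: "r dvd q ^ j \<longleftrightarrow> r = q" if "prime r" for r
    using that p q i j by (auto simp: prime_dvd_power_iff primes_dvd_imp_eq)
  have neq: "p ^ i \<noteq> q ^ j"
    using dvd_p[OF p(1)] dvd_q[OF p(1)] \<open>p < q\<close> by auto
  have "a > 0"
    using shelf \<open>a \<in> B\<close> unfolding shelves_def by auto
  define C where "C = insert (p ^ i) (insert (q ^ j) (B - {a}))"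
  have "num_multiples r C \<le> k" if r: "prime r" for r
  proof -
    have "num_multiples r C
        \<le> num_multiples r (B - {a}) + of_bool (r dvd q ^ j) + of_bool (r dvd p ^ i)"
      unfolding C_def
      using num_multiples_insert_le[of "insert (q ^ j) (B - {a})" r "p ^ i"]
        num_multiples_insert_le[of "B - {a}" r "q ^ j"] fin by simp
    \<comment> \<open>The two indicators on the left mean \<open>r = q\<close> and
      \<open>r = p\<close>. At most one of them holds, and in that case \<open>r\<close> divides
      \<open>a\<close>, so removing \<open>a\<close> pays for the new power.\<close>
    also have "\<dots> \<le> num_multiples r (B - {a}) + of_bool (r dvd a)"
      using dvd_p[OF r] dvd_q[OF r] p q \<open>p < q\<close> by auto
    also have "\<dots> = num_multiples r B"
      using num_multiples_remove[OF fin \<open>a \<in> B\<close> \<open>a > 0\<close>] .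
    also have "\<dots> \<le> k"
      using shelf r unfolding shelves_def by simp
    finally show ?thesis .
  qed
  moreover have "C \<subseteq> {1..m}"
    using shelf le \<open>p > 1\<close> \<open>q > 1\<close> unfolding C_def shelves_def by auto
  ultimately have "card C \<le> card B"
    using B unfolding max_shelves_def shelves_def by simp
  moreover have "card C = Suc (card B)"
    unfolding C_def using fin i j neq \<open>a \<in> B\<close>
    by (simp add: card_Suc_Diff1 del: card_Diff_insert)
  ultimately show False by simp
qed

lemma prime_power_of_one_prime_divisor:
  assumes "prime p" "p dvd a" "a > 0" "num_prime_divisors a \<le> 1"
  shows "a = p ^ multiplicity p a"
proof -
  have "p \<in> prime_factors a"
    using assms by (simp add: prime_factors_dvd)
  then have "prime_factors a = {p}"
    using assms(4) card_le_Suc0_iff_eq[of "prime_factors a"] unfolding num_prime_divisors_def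
    by auto
  then show ?thesis
    using prime_factorization_nat[OF assms(3)] by simp
qed

text \<open>Every multiple of \<open>p\<close> in \<open>A\<close> is a power of \<open>p\<close>,
  and \<open>p ^ k > n\<close> leaves only the \<open>k - 1\<close> exponents from 1 to
  \<open>k - 1\<close>.\<close>

lemma num_multiples_less_of_prime_powers:
  assumes A: "A \<in> shelves k n" and \<omega>: "\<And>a. a \<in> A \<Longrightarrow> num_prime_divisors a \<le> 1"
    and p: "prime p" "p ^ k > n" and "k > 0"
  shows "num_multiples p A < k"
proof -
  have "A \<inter> {a. a > 0 \<and> p dvd a} \<subseteq> (\<lambda>i. p ^ i) ` {1..<k}"
  proof
    fix a assume a: "a \<in> A \<inter> {a. a > 0 \<and> p dvd a}"
    then have eq: "a = p ^ multiplicity p a"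
      using prime_power_of_one_prime_divisor p(1) \<omega> by auto
    have "a \<le> n"
      using A a unfolding shelves_def by auto
    then have "p ^ multiplicity p a < p ^ k"
      using eq p(2) by simp
    then have "multiplicity p a < k"
      using prime_gt_1_nat[OF p(1)] by simp
    moreover have "multiplicity p a \<noteq> 0"
      using eq a p(1) by (metis IntD2 mem_Collect_eq not_prime_unit power_0)
    ultimately show "a \<in> (\<lambda>i. p ^ i) ` {1..<k}"
      using eq by (intro image_eqI[of _ _ "multiplicity p a"]) auto
  qed
  then have "num_multiples p A \<le> card ((\<lambda>i. p ^ i) ` {1..<k})"
    unfolding num_multiples_def by (intro card_mono) auto
  also have "\<dots> \<le> k - 1"
    using card_image_le[of "{1..<k}"] by simp
  finally show ?thesis
    using \<open>k > 0\<close> by simp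
qed

text \<open>In a shelf made only of 1 and prime powers, both \<open>p\<close> and \<open>q\<close>
  have room for one more multiple, so \<open>p * q\<close> can be added without violating any
  bound.\<close>

lemma max_shelf_has_two_prime_divisors:
  assumes A: "A \<in> max_shelves k n" and "k > 0"
    and p: "prime p" "p ^ k > n" and q: "prime q" "q ^ k > n"
    and "p \<noteq> q" "p * q \<le> n"
  shows "\<exists>a\<in>A. num_prime_divisors a > 1"
proof (rule ccontr)
  assume "\<not> ?thesis"
  then have \<omega>: "num_prime_divisors a \<le> 1" if "a \<in> A" for a
    using that by (simp add: not_less)
  have shelf: "A \<in> shelves k n"
    using A unfolding max_shelves_def by simp
  note fin = finite_shelf[OF shelf]
  have less: "num_multiples r A < k" if "r = p \<or> r = q" for r
    using that num_multiples_less_of_prime_powers[OF shelf \<omega>] p q \<open>k > 0\<close> by auto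
  have "p * q > 0"
    using p q prime_gt_0_nat by simp
  have "num_multiples r (insert (p * q) A) \<le> k" if r: "prime r" for r
  proof (cases "r dvd p * q")
    case True
    then have "r = p \<or> r = q"
      using r p q by (auto simp: prime_dvd_mult_iff primes_dvd_imp_eq)
    then show ?thesis
      using less[of r] num_multiples_insert_le[OF fin, of r "p * q"] True by simp
  next
    case False
    then have "num_multiples r (insert (p * q) A) \<le> num_multiples r A"
      using num_multiples_insert_le[OF fin, of r "p * q"] by simp
    also have "\<dots> \<le> k"
      using shelf r unfolding shelves_def by blast
    finally show ?thesis .
  qed
  moreover have "insert (p * q) A \<subseteq> {1..n}"
    using shelf \<open>p * q \<le> n\<close> \<open>p * q > 0\<close> unfolding shelves_def by auto
  ultimately have "card (insert (p * q) A) \<le> card A"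
    using A unfolding max_shelves_def shelves_def by simp
  \<comment> \<open>The extended set is a shelf too, so by maximality it cannot be larger than
    \<open>A\<close>. Hence \<open>p * q\<close> was there already and would have to be a power of
    \<open>p\<close>.\<close>
  then have "p * q \<in> A"
    using fin by (simp add: card_insert_if split: if_splits)
  then have "p * q = p ^ multiplicity p (p * q)"
    using prime_power_of_one_prime_divisor[OF p(1)] \<omega> \<open>p * q > 0\<close> by simp
  then have "q dvd p"
    by (metis dvd_triv_right prime_dvd_power q(1))
  then show False
    using p q \<open>p \<noteq> q\<close> primes_dvd_imp_eq by blast
qed

text \<open>The assumption \<open>ex\<close> ensures that the minimum for \<open>A\<close> is
  attained by an element; this minimum is one of the values over which \<open>ssp_bound\<close>
  takes the maximum.\<close>

lemma ssp_bound_attained: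
  assumes A: "A \<in> max_shelves k n" and ex: "\<exists>a\<in>A. num_prime_divisors a > 1"
  shows "\<exists>a\<in>A. num_prime_divisors a > 1 \<and> ssp a ^ k \<le> ssp_bound k n"
proof -
  let ?S = "{a \<in> A. num_prime_divisors a > 1}"
  have "finite A"
    using A finite_shelf unfolding max_shelves_def by auto
  then have "(MIN a \<in> ?S. ssp a ^ k) \<in> (\<lambda>a. ssp a ^ k) ` ?S"
    using ex by (intro Min_in) auto
  moreover have "(MIN a \<in> ?S. ssp a ^ k) \<le> ssp_bound k n"
    unfolding ssp_bound_def using A finite_max_shelves by (intro Max_ge) auto
  ultimately show ?thesis
    by force
qed

lemma ssp_second_prime_divisor:
  assumes "num_prime_divisors a > 1"
  obtains p where "prime p" "p dvd a" "prime (ssp a)" "ssp a dvd a" "p < ssp a"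
proof -
  define p where "p = Min (prime_factors a)"
  have ne: "prime_factors a \<noteq> {}"
    using assms unfolding num_prime_divisors_def by auto
  then have p: "p \<in> prime_factors a"
    unfolding p_def by (intro Min_in) auto
  \<comment> \<open>With two prime factors, one survives the removal of the smallest, so the outer
    \<open>Min\<close> in \<open>ssp\<close> is a genuine element.\<close>
  have "prime_factors a - {p} \<noteq> {}"
    using assms unfolding num_prime_divisors_def
    by (metis Diff_eq_empty_iff card_mono card.empty card.insert empty_iff finite.intros
        is_singletonI is_singleton_altdef not_less One_nat_def)
  then have q: "ssp a \<in> prime_factors a - {p}"
    unfolding ssp_def p_def by (intro Min_in) auto
  moreover have "p \<le> ssp a"
    using q unfolding p_def by (intro Min_le) auto
  ultimately show ?thesis
    using that[of p] p by (auto simp: in_prime_factors_iff)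
qed

lemma finite_primes_le: "finite {p::nat. prime p \<and> real p \<le> x}"
proof (rule finite_subset)
  show "{p::nat. prime p \<and> real p \<le> x} \<subseteq> {..nat \<lfloor>x\<rfloor>}"
    by (auto simp: le_nat_floor)
qed simp

lemma two_primes_between:
  assumes "int (prime_pi y) - int (prime_pi x) \<ge> 2"
  obtains p q where "prime p" "prime q" "p < q" "x < real p" "real q \<le> y"
proof -
  let ?P = "\<lambda>x. {p::nat. prime p \<and> real p \<le> x}"
  have "2 \<le> card (?P y) - card (?P x)"
    using assms unfolding prime_pi_def by linarith
  \<comment> \<open>The difference of cardinalities bounds the cardinality of the set difference
    from below, whatever the order of \<open>x\<close> and \<open>y\<close>; its members are the
    primes above \<open>x\<close> and at most \<open>y\<close>.\<close>
  also have "\<dots> \<le> card (?P y - ?P x)"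
    by (rule diff_card_le_card_Diff) (rule finite_primes_le)
  finally obtain p q where "p \<in> ?P y - ?P x" "q \<in> ?P y - ?P x" "p \<noteq> q"
    by (meson card_2_iff' obtain_subset_with_card_n subsetD)
  then show ?thesis
    using that[of p q] that[of q p] by (cases p q rule: linorder_cases) auto
qed

theorem proposition1:
  fixes k n m :: nat
  assumes "k > 2"
    and "n > 0"
    and "int (prime_pi (sqrt (real n))) - int (prime_pi (root k (real n))) \<ge> 2"
    and "m > 0"
    and "m \<ge> ssp_bound k n"
  shows "\<forall>A \<in> max_shelves k n. \<forall>B \<in> max_shelves k m. \<not> A \<subseteq> B"
proof (intro ballI notI)
  fix A B assume A: "A \<in> max_shelves k n" and B: "B \<in> max_shelves k m" and "A \<subseteq> B"
  obtain p q where pq: "prime p" "prime q" "p < q" "root k n < real p" "real q \<le> sqrt n"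
    using two_primes_between[OF assms(3)] .
  have pow: "r ^ k > n" if "root k n < real r" for r :: nat
  proof -
    have "real n = root k n ^ k"
      using \<open>k > 2\<close> by simp
    also have "\<dots> < real r ^ k"
      using that \<open>k > 2\<close> by (intro power_strict_mono) auto
    finally show ?thesis
      by (metis of_nat_less_iff of_nat_power)
  qed
  \<comment> \<open>The upper end \<open>sqrt n\<close> of the interval makes \<open>p * q\<close>
    fit into \<open>{1..n}\<close>, while the lower end gave \<open>p ^ k > n\<close> and
    \<open>q ^ k > n\<close> through \<open>pow\<close>.\<close>
  have "real p * real q \<le> sqrt n * sqrt n"
    using pq by (intro mult_mono) auto
  then have "p * q \<le> n"
    by (simp flip: of_nat_mult)
  then have "\<exists>a\<in>A. num_prime_divisors a > 1"
    using max_shelf_has_two_prime_divisors[OF A _ pq(1) _ pq(2)] pow pq \<open>k > 2\<close> by simp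
  then obtain a where a: "a \<in> A" "num_prime_divisors a > 1" "ssp a ^ k \<le> m"
    using ssp_bound_attained[OF A] assms(5) le_trans by blast
  obtain r where "prime r" "r dvd a" "prime (ssp a)" "ssp a dvd a" "r < ssp a"
    using ssp_second_prime_divisor[OF a(2)] .
  \<comment> \<open>As \<open>a\<close> also lies in \<open>B\<close>, the exchange argument applies
    with \<open>ssp a\<close> as the larger prime.\<close>
  then have "ssp a ^ k > m"
    using max_shelf_prime_power_gt[OF B] a(1) \<open>A \<subseteq> B\<close> by blast
  then show False
    using a(3) by simp
qed

end
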